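(* Assume that $a$ is convex (i.e. each $a_i$, $i=1,\dots,m$, is convex) and that the feasible region $\{x\in\mathbb{R}^n: a(x)\le 0\}$ has empty interior. Let $\{(x^k,y^k,s^k,\mu^k)\}\subset\mathbb{R}^n\times\mathbb{R}^m\times\mathbb{R}^m\times\mathbb{R}$ with $\mu^k>0$ for all $k$ and $\mu^k\to 0$ be such that: 1. $x^k\to x^*$ with $a(x^* )\le 0$, and $s^k\to -a(x^* )$; 2. $y^k\ge 0$ and $s^k\ge 0$; 3. for some $b>0$ (independent of $k$), $\mu^k b\le y_i^k s_i^k$ for all $i$ with $a_i(x^* )=0$; 4. $\dfrac{a_i(x^k)+s_i^k}{\mu^k}\to 0$ for all $i$ with $a_i(x^* )=0$. Then $\{y^k\}$ is unbounded.
   Context: The function $a=(a_1,\dots,a_m):\mathbb{R}^n\to\mathbb{R}^m$ is continuously differentiable. Vector inequalities are componentwise. Conditions on sequence elements stated without an explicit quantifier over $k$ are meant for all sufficiently large $k$. *)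

theory Defs
  imports "HOL-Analysis.Analysis"
begin

definition continuously_differentiable :: "('a::real_normed_vector \<Rightarrow> 'b::real_normed_vector) \<Rightarrow> bool"
  where "continuously_differentiable f \<longleftrightarrow>
    (\<exists>f' :: 'a \<Rightarrow> 'a \<Rightarrow>\<^sub>L 'b.
      (\<forall>x. (f has_derivative blinfun_apply (f' x)) (at x)) \<and> continuous_on UNIV f')"

(* The order on vectors is the componentwise one (less_eq_vec_def). *)
definition feasible_region :: "(real ^ 'n \<Rightarrow> real ^ 'm) \<Rightarrow> (real ^ 'n) set"
  where "feasible_region a = {x. a x \<le> 0}"

end

theory Submission
  imports Defs
begin

text \<open>
  If \<open>y\<close> were bounded by \<open>B\<close>, then \<open>s i \<ge> \<mu> b / B\<close> for every active
  constraint \<open>i\<close>, and \<open>a i (x k) + s i\<close> is eventually smaller than this, so \<open>a i (x k) < 0\<close>.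
  Inactive constraints are strict at \<open>x k\<close> by continuity. Hence some \<open>x k\<close> is strictly feasible,
  and by continuity an interior point of the feasible region.
\<close>

text \<open>By continuity each strict inequality holds on an open set, and the intersection over the
  finitely many components is an open neighbourhood of \<open>z\<close> inside the region.\<close>

lemma strictly_feasible_in_interior:
  assumes "continuous_on UNIV a" and "\<And>i. a z $ i < 0"
  shows "z \<in> interior (feasible_region a)"
proof (rule interiorI)
  have "open {u. \<forall>i. a u $ i < 0}"
    unfolding Collect_all_eq
    by (intro open_INT ballI finite open_Collect_less continuous_on_component assms(1) continuous_on_const)
  then show "open {u. \<forall>i. a u $ i < 0}" .
  show "z \<in> {u. \<forall>i. a u $ i < 0}"
    using assms(2) by simp
  show "{u. \<forall>i. a u $ i < 0} \<subseteq> feasible_region a"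
    by (auto simp: feasible_region_def less_eq_vec_def intro: less_imp_le)
qed

text \<open>One active constraint at one iterate, with \<open>c\<close> in the role of
  \<open>a (x k) $ i\<close>. Replacing \<open>y\<close> by its bound \<open>B\<close> in the
  complementarity estimate gives \<open>b / B \<le> s / \<mu>\<close>, so the scaled residual can
  stay below \<open>b / B\<close> only if \<open>c\<close> is negative.\<close>

lemma bounded_dual_strictly_negative:
  fixes y s \<mu> c b B :: real
  assumes "0 < \<mu>" "0 < b" "0 < B" "0 \<le> s" "y \<le> B" "\<mu> * b \<le> y * s"
    and "(c + s) / \<mu> < b / B"
  shows "c < 0"
proof -
  have "\<mu> * b \<le> B * s"
    using mult_right_mono[OF \<open>y \<le> B\<close> \<open>0 \<le> s\<close>] assms(6) by linarith
  then have "b / B \<le> s / \<mu>"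
    using assms(1,3) by (simp add: field_simps)
  then have "c / \<mu> < 0"
    using assms(7) by (simp add: add_divide_distrib)
  then show ?thesis
    using assms(1) by (simp add: divide_less_0_iff)
qed

theorem theorem5:
  fixes a :: "real ^ 'n \<Rightarrow> real ^ 'm"
    and x :: "nat \<Rightarrow> real ^ 'n" and y s :: "nat \<Rightarrow> real ^ 'm" and \<mu> :: "nat \<Rightarrow> real"
    and xstar :: "real ^ 'n"
  assumes "continuously_differentiable a"
    and "\<And>i. convex_on UNIV (\<lambda>z. a z $ i)"
    and "interior (feasible_region a) = {}"
    and "\<And>k. \<mu> k > 0" and "\<mu> \<longlonglongrightarrow> 0"
    and "x \<longlonglongrightarrow> xstar" and "a xstar \<le> 0" and "s \<longlonglongrightarrow> - a xstar"
    and "\<forall>\<^sub>F k in sequentially. y k \<ge> 0 \<and> s k \<ge> 0"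
    and "\<exists>b>0. \<forall>\<^sub>F k in sequentially. \<forall>i. a xstar $ i = 0 \<longrightarrow> \<mu> k * b \<le> y k $ i * s k $ i"
    and "\<And>i. a xstar $ i = 0 \<Longrightarrow> (\<lambda>k. (a (x k) $ i + s k $ i) / \<mu> k) \<longlonglongrightarrow> 0"
  shows "\<not> bounded (range y)"
proof
  assume "bounded (range y)"
  then obtain B where "B > 0" and B: "\<And>k. norm (y k) \<le> B"
    by (auto simp: bounded_pos)
  obtain b where "b > 0"
    and b: "\<forall>\<^sub>F k in sequentially. \<forall>i. a xstar $ i = 0 \<longrightarrow> \<mu> k * b \<le> y k $ i * s k $ i"
    using assms(10) by blast
  have cont: "continuous_on UNIV a"
    using assms(1) unfolding continuously_differentiable_def
    by (auto intro!: continuous_at_imp_continuous_on dest: has_derivative_continuous)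
  have "\<forall>\<^sub>F k in sequentially. a (x k) $ i < 0" for i
  proof (cases "a xstar $ i = 0")
    case True
    \<comment> \<open>The threshold \<open>b / B\<close> is positive and independent of
      \<open>k\<close>, so a residual tending to 0 eventually drops below it.\<close>
    have "\<forall>\<^sub>F k in sequentially. (a (x k) $ i + s k $ i) / \<mu> k < b / B"
      using order_tendstoD(2)[OF assms(11)[OF True]] \<open>b > 0\<close> \<open>B > 0\<close> by simp
    then show ?thesis
      using assms(9) b
    proof eventually_elim
      case (elim k)
      have "0 \<le> s k $ i"
        using elim(2) by (simp add: less_eq_vec_def)
      moreover have "y k $ i \<le> B"
        using component_le_norm_cart[of "y k" i] B[of k] by linarith
      moreover have "\<mu> k * b \<le> y k $ i * s k $ i"
        using elim(3) True by blast
      ultimately show ?case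
        using bounded_dual_strictly_negative assms(4) \<open>b > 0\<close> \<open>B > 0\<close> elim(1) by blast
    qed
  next
    case False
    then have "a xstar $ i < 0"
      using assms(7) by (simp add: less_eq_vec_def order_less_le)
    moreover have "(\<lambda>k. a (x k) $ i) \<longlonglongrightarrow> a xstar $ i"
      by (intro tendsto_vec_nth continuous_on_tendsto_compose[OF cont assms(6)]) auto
    ultimately show ?thesis
      by (rule order_tendstoD(2)[rotated])
  qed
  \<comment> \<open>How large \<open>k\<close> must be may depend on \<open>i\<close>; since there
    are finitely many components, one bound serves them all.\<close>
  then have "\<forall>\<^sub>F k in sequentially. \<forall>i. a (x k) $ i < 0"
    by (simp add: eventually_all_finite)
  then obtain k where "\<And>i. a (x k) $ i < 0"
    using eventually_happens' sequentially_bot by blast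
  then show False
    using strictly_feasible_in_interior[OF cont] assms(3) by blast
qed

end
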